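(* Let $T=(\Lambda,S,\Delta)$ be a Turing machine (with $s_0$ not in the image of $\Delta_2$). The formula $\phi_T\rightarrow C\neg s_\mathit{end}$ is valid (true at every world of every model) if and only if $T$ is non-halting. Furthermore, $\phi_T\rightarrow\neg C\neg s_\mathit{end}$ is valid if and only if $T$ is halting.
   Context: Logic AAULC. Fix a countable set $\mathcal{P}$ of propositional atoms and a finite set $\mathcal{A}$ of agents containing five distinct agents $a,\mathit{left},\mathit{right},\mathit{up},\mathit{down}$. The language $\mathcal{L}_\mathit{AAULC}$ is $\phi ::= p \mid \neg\phi \mid \phi\vee\phi \mid \square_x\phi \mid C\phi \mid [U]\phi \mid [\forall]\phi$ with $p\in\mathcal{P}$, $x\in\mathcal{A}$, where an arrow update $U$ is a finite set of clauses $(\phi_1,x,\phi_2)$ with $\phi_1,\phi_2$ formulas and $x\in\mathcal{A}$. $\mathcal{L}_\mathit{AULC}$ is the fragment without $[\forall]$ (also inside updates). $\wedge,\rightarrow,\top,\bot,\lozenge_x=\neg\square_x\neg$ are the usual abbreviations. A model is $\mathcal{M}=(W,R,V)$ with $W$ a set, $R(x)\subseteq W\times W$ an arbitrary relation for each $x\in\mathcal{A}$, $V:\mathcal{P}\to 2^W$. Semantics: Booleans and atoms as usual; $\mathcal{M},w\models\square_x\phi$ iff $\phi$ holds at all $R(x)$-successors of $w$; $\mathcal{M},w\models C\phi$ iff $\phi$ holds at every world reachable from $w$ by a finite path of length $\geq 1$ whose steps are in $\bigcup_{x\in\mathcal{A}}R(x)$; $\mathcal{M},w\models[U]\phi$ iff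 $\mathcal{M}*U,w\models\phi$, where $\mathcal{M}*U=(W,R*U,V)$ and $R*U(x)=\{(w_1,w_2)\in R(x)\mid \exists(\phi_1,x,\phi_2)\in U:\ \mathcal{M},w_1\models\phi_1,\ \mathcal{M},w_2\models\phi_2\}$; $\mathcal{M},w\models[\forall]\phi$ iff $\mathcal{M},w\models[U]\phi$ for every arrow update $U$ all of whose formulas lie in $\mathcal{L}_\mathit{AULC}$. Turing machines. A Turing machine is $T=(\Lambda,S,\Delta)$ with $\Lambda$ a finite alphabet containing $\alpha_0$, $S$ a finite set of states containing $s_0,s_\mathit{end}$, and $\Delta:\Lambda\times S\to\Lambda\times S\times\{\mathit{left},\mathit{remain},\mathit{right}\}$; $\Delta_1,\Delta_2,\Delta_3$ are its components (symbol written, next state, head move). It is assumed that $s_0$ never re-occurs, i.e. $s_0\notin$ image of $\Delta_2$. $T$ halts if, started in state $s_0$ on a two-way infinite tape containing only the symbol $\alpha_0$, its (deterministic) run reaches the state $s_\mathit{end}$; otherwise it is non-halting. Let $s_\mathit{void}$ be a fresh state symbol not in $S$; put $\mathit{states}=S\cup\{s_\mathit{void}\}$. Assume the elements of $\mathit{states}$, $\Lambda$ and three further symbols $\mathit{pos},\mathit{lpos},\mathit{rpos}$ are pairwise distinct atoms in $\mathcal{P}$. The formula $\phi_T := C\psi_\mathit{grid}\wedge C\psi_\mathit{sane}\wedge C\psi_T\wedge s_0\wedge\mathit{pos}$, where: $D=\{\mathit{left},\mathit{right},\mathit{up},\mathit{down}\}$; $\mathit{INV}=\{(\mathit{left},\mathit{right}),(\mathit{right},\mathit{left}),(\mathit{up},\mathit{down}),(\mathit{down},\mathit{up})\}$;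 $\mathit{COMM}=(\{\mathit{up},\mathit{down}\}\times\{\mathit{left},\mathit{right}\})\cup(\{\mathit{left},\mathit{right}\}\times\{\mathit{up},\mathit{down}\})$; $\psi_\mathit{grid}=\mathit{ref}_a\wedge\mathit{no\_other}\wedge\mathit{direction}\wedge\mathit{inverse}\wedge\mathit{commute}$ with $\mathit{ref}_a=\lozenge_a\top\wedge[\forall]\square_a\lozenge_a\top$; $\mathit{no\_other}=\bigwedge_{x\in\mathcal{A}\setminus(D\cup\{a\})}\square_x\bot$; $\mathit{direction}=\bigwedge_{x\in D}(\lozenge_x\top\wedge[\forall](\lozenge_x\lozenge_a\top\rightarrow\square_x\lozenge_a\top))$; $\mathit{inverse}=[\forall](\lozenge_a\top\rightarrow\bigwedge_{(x,y)\in\mathit{INV}}\square_x\square_y\lozenge_a\top)$; $\mathit{commute}=[\forall]\bigwedge_{(x,y)\in\mathit{COMM}}(\lozenge_x\lozenge_y\lozenge_a\top\rightarrow\square_y\square_x\lozenge_a\top)$. $\psi_\mathit{sane}$ is the conjunction of: $\neg(\mathit{pos}\wedge\mathit{lpos})\wedge\neg(\mathit{pos}\wedge\mathit{rpos})\wedge\neg(\mathit{rpos}\wedge\mathit{lpos})$; $((\mathit{pos}\vee\mathit{rpos})\rightarrow\square_\mathit{right}\mathit{rpos})\wedge((\mathit{pos}\vee\mathit{lpos})\rightarrow\square_\mathit{left}\mathit{lpos})$; $\bigvee_{s\in\mathit{states}}(s\wedge\bigwedge_{s'\in\mathit{states}\setminus\{s\}}\neg s')$; $\bigwedge_{s\in\mathit{states}}(s\rightarrow(\square_\mathit{left}s\wedge\square_\mathit{right}s))$;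 $\bigvee_{\alpha\in\Lambda}(\alpha\wedge\bigwedge_{\beta\in\Lambda\setminus\{\alpha\}}\neg\beta)$; $(s_0\vee s_\mathit{void})\rightarrow\square_\mathit{down}s_\mathit{void}$; $s_0\rightarrow\alpha_0$; $\bigwedge_{\alpha\in\Lambda}((\neg\mathit{pos}\wedge\alpha)\rightarrow\square_\mathit{up}\alpha)$. $\psi_T$ is the conjunction of: for all $(\alpha,s)\in\Lambda\times S$ with $\Delta_3(\alpha,s)=\mathit{left}$: $(\mathit{pos}\wedge s\wedge\alpha)\rightarrow\square_\mathit{up}\square_\mathit{left}\mathit{pos}$; with $\Delta_3(\alpha,s)=\mathit{right}$: $(\mathit{pos}\wedge s\wedge\alpha)\rightarrow\square_\mathit{up}\square_\mathit{right}\mathit{pos}$; with $\Delta_3(\alpha,s)=\mathit{remain}$: $(\mathit{pos}\wedge s\wedge\alpha)\rightarrow\square_\mathit{up}\mathit{pos}$; for all $(\alpha,s)$: $(\mathit{pos}\wedge s\wedge\alpha)\rightarrow\square_\mathit{up}\Delta_2(\alpha,s)$ and $(\mathit{pos}\wedge s\wedge\alpha)\rightarrow\square_\mathit{up}\Delta_1(\alpha,s)$.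
   Formalization: C is read as truth at every world reachable in zero or more steps, so the evaluation world is included; with at least one step required, both equivalences fail (e.g. a single world without successors satisfying s_0 and pos). *)

theory Defs
  imports Main "HOL-Library.FSet" "HOL-Library.Countable"
begin

datatype ('p, 'x) fm =
    Atom 'p
  | Neg "('p, 'x) fm"
  | Or "('p, 'x) fm" "('p, 'x) fm"
  | Box 'x "('p, 'x) fm"
  | CK "('p, 'x) fm"
  | Upd "(('p, 'x) fm \<times> 'x \<times> ('p, 'x) fm) fset" "('p, 'x) fm"
  | All "('p, 'x) fm"

type_synonym ('p, 'x) arrow_update = "(('p, 'x) fm \<times> 'x \<times> ('p, 'x) fm) fset"

definition And :: "('p, 'x) fm \<Rightarrow> ('p, 'x) fm \<Rightarrow> ('p, 'x) fm" where
  "And \<phi> \<psi> = Neg (Or (Neg \<phi>) (Neg \<psi>))"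

definition Imp :: "('p, 'x) fm \<Rightarrow> ('p, 'x) fm \<Rightarrow> ('p, 'x) fm" where
  "Imp \<phi> \<psi> = Or (Neg \<phi>) \<psi>"

text \<open>The atom used in the definition of truth is arbitrary.\<close>

definition Top :: "('p, 'x) fm" where
  "Top = Or (Atom (SOME p. True)) (Neg (Atom (SOME p. True)))"

definition Bot :: "('p, 'x) fm" where
  "Bot = Neg Top"

definition Dia :: "'x \<Rightarrow> ('p, 'x) fm \<Rightarrow> ('p, 'x) fm" where
  "Dia x \<phi> = Neg (Box x (Neg \<phi>))"

text \<open>
  Conjunctions and disjunctions over a finite index set are formed in an arbitrary order. They
  are only meaningful for finite index sets.
\<close>

definition some_list :: "'i set \<Rightarrow> 'i list" where
  "some_list I = (SOME is. set is = I \<and> distinct is)"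

definition BigAnd :: "'i set \<Rightarrow> ('i \<Rightarrow> ('p, 'x) fm) \<Rightarrow> ('p, 'x) fm" where
  "BigAnd I f = foldr And (map f (some_list I)) Top"

definition BigOr :: "'i set \<Rightarrow> ('i \<Rightarrow> ('p, 'x) fm) \<Rightarrow> ('p, 'x) fm" where
  "BigOr I f = foldr Or (map f (some_list I)) Bot"

lemma size_clause:
  assumes "(\<phi>1, x, \<phi>2) |\<in>| U"
  shows "size \<phi>1 < size (Upd U \<phi>)" "size \<phi>2 < size (Upd U \<phi>)"
proof -
  let ?g = "map_prod (\<lambda>\<phi> :: ('a, 'b) fm. (\<phi>, size \<phi>)) (map_prod (\<lambda>x :: 'b. x) (\<lambda>\<phi> :: ('a, 'b) fm. (\<phi>, size \<phi>)))"
  let ?f = "\<lambda>c. Suc (size_prod snd (size_prod (\<lambda>_. 0) snd) c)"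
  have "?f (?g (\<phi>1, x, \<phi>2)) \<le> (\<Sum>c \<in> ?g ` fset U. ?f c)"
    using assms by (intro member_le_sum imageI) auto
  then show "size \<phi>1 < size (Upd U \<phi>)" "size \<phi>2 < size (Upd U \<phi>)"
    by auto
qed

lemma size_body: "size \<phi> < size (Upd U \<phi>)"
  by simp

function aulc :: "('p, 'x) fm \<Rightarrow> bool" where
  "aulc (Atom p) \<longleftrightarrow> True"
| "aulc (Neg \<phi>) \<longleftrightarrow> aulc \<phi>"
| "aulc (Or \<phi> \<psi>) \<longleftrightarrow> aulc \<phi> \<and> aulc \<psi>"
| "aulc (Box x \<phi>) \<longleftrightarrow> aulc \<phi>"
| "aulc (CK \<phi>) \<longleftrightarrow> aulc \<phi>"
| "aulc (Upd U \<phi>) \<longleftrightarrow> (\<forall>\<phi>1 x \<phi>2. (\<phi>1, x, \<phi>2) |\<in>| U \<longrightarrow> aulc \<phi>1 \<and> aulc \<phi>2) \<and> aulc \<phi>"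
| "aulc (All \<phi>) \<longleftrightarrow> False"
  by pat_completeness auto
termination
  by (relation "measure size") (auto simp: size_clause size_body simp del: fm.size(13))

definition aulc_update :: "('p, 'x) arrow_update \<Rightarrow> bool" where
  "aulc_update U \<longleftrightarrow> (\<forall>\<phi>1 x \<phi>2. (\<phi>1, x, \<phi>2) |\<in>| U \<longrightarrow> aulc \<phi>1 \<and> aulc \<phi>2)"

text \<open>The number of arbitrary update operators, which decreases in the last clause of the semantics.\<close>

function num_all :: "('p, 'x) fm \<Rightarrow> nat" where
  "num_all (Atom p) = 0"
| "num_all (Neg \<phi>) = num_all \<phi>"
| "num_all (Or \<phi> \<psi>) = num_all \<phi> + num_all \<psi>"
| "num_all (Box x \<phi>) = num_all \<phi>"
| "num_all (CK \<phi>) = num_all \<phi>"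
| "num_all (Upd U \<phi>) = (\<Sum>(\<phi>1, x, \<phi>2) \<in> fset U. num_all \<phi>1 + num_all \<phi>2) + num_all \<phi>"
| "num_all (All \<phi>) = Suc (num_all \<phi>)"
  by pat_completeness auto
termination
  by (relation "measure size") (auto simp: size_clause size_body simp del: fm.size(13))

lemma num_all_aulc: "aulc \<phi> \<Longrightarrow> num_all \<phi> = 0"
  by (induction \<phi> rule: aulc.induct) auto

lemma num_all_aulc_update: "aulc_update U \<Longrightarrow> num_all (Upd U \<phi>) < num_all (All \<phi>)"
  by (auto simp: less_Suc_eq_le aulc_update_def num_all_aulc intro!: sum.neutral)

lemma num_all_clause:
  assumes "(\<phi>1, x, \<phi>2) |\<in>| U"
  shows "num_all \<phi>1 \<le> num_all (Upd U \<phi>)" "num_all \<phi>2 \<le> num_all (Upd U \<phi>)"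
proof -
  let ?f = "\<lambda>(\<phi>1, x, \<phi>2). num_all \<phi>1 + num_all \<phi>2"
  have "?f (\<phi>1, x, \<phi>2) \<le> (\<Sum>c \<in> fset U. ?f c)"
    using assms by (intro member_le_sum) auto
  then show "num_all \<phi>1 \<le> num_all (Upd U \<phi>)" "num_all \<phi>2 \<le> num_all (Upd U \<phi>)"
    by auto
qed

lemma num_all_body: "num_all \<phi> \<le> num_all (Upd U \<phi>)"
  by simp

lemma lex_less_thanI:
  "m \<le> m' \<Longrightarrow> n < n' \<Longrightarrow> ((m, n), (m', n')) \<in> less_than <*lex*> less_than"
  "m < m' \<Longrightarrow> ((m, n), (m', n')) \<in> less_than <*lex*> less_than"
  by auto

record ('w, 'p, 'x) model =
  worlds :: "'w set"
  rel :: "'x \<Rightarrow> ('w \<times> 'w) set"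
  val :: "'p \<Rightarrow> 'w set"

definition is_model :: "('w, 'p, 'x) model \<Rightarrow> bool" where
  "is_model M \<longleftrightarrow> (\<forall>x. rel M x \<subseteq> worlds M \<times> worlds M) \<and> (\<forall>p. val M p \<subseteq> worlds M)"

text \<open>
  The length of a path is counted in worlds: a path of length $n \geq 1$ visits worlds
  $w_1, \dots, w_n$, so the path consisting of the evaluation point alone is included and
  \<open>CK\<close> uses the reflexive transitive closure. This matters: if at least one step were
  required, \<open>phi_T\<close> below would constrain the evaluation point only by two atoms. It would
  then hold at a world without successors, and also at a world with an arbitrary unrelated grid
  above it, so that both equivalences between validity and (non-)halting would fail.
\<close>

function sem :: "('w, 'p, 'x) model \<Rightarrow> 'w \<Rightarrow> ('p, 'x) fm \<Rightarrow> bool" where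
  "sem M w (Atom p) \<longleftrightarrow> w \<in> val M p"
| "sem M w (Neg \<phi>) \<longleftrightarrow> \<not> sem M w \<phi>"
| "sem M w (Or \<phi> \<psi>) \<longleftrightarrow> sem M w \<phi> \<or> sem M w \<psi>"
| "sem M w (Box x \<phi>) \<longleftrightarrow> (\<forall>v. (w, v) \<in> rel M x \<longrightarrow> sem M v \<phi>)"
| "sem M w (CK \<phi>) \<longleftrightarrow> (\<forall>v. (w, v) \<in> (\<Union>x. rel M x)\<^sup>* \<longrightarrow> sem M v \<phi>)"
| "sem M w (Upd U \<phi>) \<longleftrightarrow>
     sem (M\<lparr>rel := \<lambda>x. {(w1, w2). (w1, w2) \<in> rel M x \<and>
            (\<exists>(\<phi>1, y, \<phi>2) \<in> fset U. y = x \<and> sem M w1 \<phi>1 \<and> sem M w2 \<phi>2)}\<rparr>) w \<phi>"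
| "sem M w (All \<phi>) \<longleftrightarrow> (\<forall>U. aulc_update U \<longrightarrow> sem M w (Upd U \<phi>))"
  by pat_completeness auto
termination
proof (relation "inv_image (less_than <*lex*> less_than) (\<lambda>(M, w, \<phi>). (num_all \<phi>, size \<phi>))",
    goal_cases)
  case 1
  show ?case by blast
qed (auto simp: size_clause size_body num_all_body num_all_aulc_update num_all_clause
      lex_less_thanI simp del: num_all.simps(6,7) in_lex_prod fm.size(13))

text \<open>
  One cannot quantify over the type of worlds inside a formula, so it is a parameter here. Since
  the set of worlds of a model is an arbitrary subset of \<open>'w\<close>, an infinite \<open>'w\<close> covers all finite
  and countably infinite models.
\<close>

definition valid :: "'w itself \<Rightarrow> ('p, 'x) fm \<Rightarrow> bool" where
  "valid _ \<phi> \<longleftrightarrow> (\<forall>M :: ('w, 'p, 'x) model. is_model M \<longrightarrow> (\<forall>w \<in> worlds M. sem M w \<phi>))"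

datatype move = MLeft | MRemain | MRight

record ('l, 's) tm =
  alphabet :: "'l set"
  blank :: 'l
  states :: "'s set"
  start :: 's
  final :: 's
  trans :: "'l \<times> 's \<Rightarrow> 'l \<times> 's \<times> move"

abbreviation trans1 :: "('l, 's) tm \<Rightarrow> 'l \<times> 's \<Rightarrow> 'l" where
  "trans1 T c \<equiv> fst (trans T c)"

abbreviation trans2 :: "('l, 's) tm \<Rightarrow> 'l \<times> 's \<Rightarrow> 's" where
  "trans2 T c \<equiv> fst (snd (trans T c))"

abbreviation trans3 :: "('l, 's) tm \<Rightarrow> 'l \<times> 's \<Rightarrow> move" where
  "trans3 T c \<equiv> snd (snd (trans T c))"

definition turing_machine :: "('l, 's) tm \<Rightarrow> bool" where
  "turing_machine T \<longleftrightarrow>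
     finite (alphabet T) \<and> blank T \<in> alphabet T \<and>
     finite (states T) \<and> start T \<in> states T \<and> final T \<in> states T \<and>
     (\<forall>c \<in> alphabet T \<times> states T. trans1 T c \<in> alphabet T \<and> trans2 T c \<in> states T)"

text \<open>A configuration consists of the current state, the head position and the tape.\<close>

type_synonym ('l, 's) config = "'s \<times> int \<times> (int \<Rightarrow> 'l)"

fun move_head :: "move \<Rightarrow> int \<Rightarrow> int" where
  "move_head MLeft i = i - 1"
| "move_head MRemain i = i"
| "move_head MRight i = i + 1"

fun step :: "('l, 's) tm \<Rightarrow> ('l, 's) config \<Rightarrow> ('l, 's) config" where
  "step T (s, i, t) =
     (trans2 T (t i, s), move_head (trans3 T (t i, s)) i, t(i := trans1 T (t i, s)))"

definition init_config :: "('l, 's) tm \<Rightarrow> ('l, 's) config" where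
  "init_config T = (start T, 0, \<lambda>_. blank T)"

definition halts :: "('l, 's) tm \<Rightarrow> bool" where
  "halts T \<longleftrightarrow> (\<exists>n. fst ((step T ^^ n) (init_config T)) = final T)"

text \<open>
  The agents are \<open>a\<close>, left \<open>l\<close>, right \<open>r\<close>, up \<open>u\<close>, down \<open>d\<close>, and all others in the type \<open>'x\<close>.
\<close>

definition INV :: "'x \<Rightarrow> 'x \<Rightarrow> 'x \<Rightarrow> 'x \<Rightarrow> ('x \<times> 'x) set" where
  "INV l r u d = {(l, r), (r, l), (u, d), (d, u)}"

definition COMM :: "'x \<Rightarrow> 'x \<Rightarrow> 'x \<Rightarrow> 'x \<Rightarrow> ('x \<times> 'x) set" where
  "COMM l r u d = {u, d} \<times> {l, r} \<union> {l, r} \<times> {u, d}"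

definition ref_a :: "'x \<Rightarrow> ('p, 'x) fm" where
  "ref_a a = And (Dia a Top) (All (Box a (Dia a Top)))"

definition no_other :: "'x \<Rightarrow> 'x \<Rightarrow> 'x \<Rightarrow> 'x \<Rightarrow> 'x \<Rightarrow> ('p, 'x) fm" where
  "no_other a l r u d = BigAnd (UNIV - ({l, r, u, d} \<union> {a})) (\<lambda>x. Box x Bot)"

definition direction :: "'x \<Rightarrow> 'x \<Rightarrow> 'x \<Rightarrow> 'x \<Rightarrow> 'x \<Rightarrow> ('p, 'x) fm" where
  "direction a l r u d = BigAnd {l, r, u, d}
     (\<lambda>x. And (Dia x Top) (All (Imp (Dia x (Dia a Top)) (Box x (Dia a Top)))))"

definition inverse_fm :: "'x \<Rightarrow> 'x \<Rightarrow> 'x \<Rightarrow> 'x \<Rightarrow> 'x \<Rightarrow> ('p, 'x) fm" where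
  "inverse_fm a l r u d =
     All (Imp (Dia a Top) (BigAnd (INV l r u d) (\<lambda>(x, y). Box x (Box y (Dia a Top)))))"

definition commute :: "'x \<Rightarrow> 'x \<Rightarrow> 'x \<Rightarrow> 'x \<Rightarrow> 'x \<Rightarrow> ('p, 'x) fm" where
  "commute a l r u d =
     All (BigAnd (COMM l r u d)
       (\<lambda>(x, y). Imp (Dia x (Dia y (Dia a Top))) (Box y (Box x (Dia a Top)))))"

definition psi_grid :: "'x \<Rightarrow> 'x \<Rightarrow> 'x \<Rightarrow> 'x \<Rightarrow> 'x \<Rightarrow> ('p, 'x) fm" where
  "psi_grid a l r u d =
     And (ref_a a) (And (no_other a l r u d) (And (direction a l r u d)
       (And (inverse_fm a l r u d) (commute a l r u d))))"

text \<open>States and tape symbols of the machine are themselves atoms.\<close>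

definition psi_sane ::
  "'x \<Rightarrow> 'x \<Rightarrow> 'x \<Rightarrow> 'x \<Rightarrow> 'p \<Rightarrow> 'p \<Rightarrow> 'p \<Rightarrow> 'p \<Rightarrow> ('p, 'p) tm \<Rightarrow> ('p, 'x) fm" where
  "psi_sane l r u d void pos lpos rpos T =
    (let Sts = states T \<union> {void}; Al = alphabet T in
     And (And (Neg (And (Atom pos) (Atom lpos))) (And (Neg (And (Atom pos) (Atom rpos)))
            (Neg (And (Atom rpos) (Atom lpos)))))
    (And (And (Imp (Or (Atom pos) (Atom rpos)) (Box r (Atom rpos)))
            (Imp (Or (Atom pos) (Atom lpos)) (Box l (Atom lpos))))
    (And (BigOr Sts (\<lambda>s. And (Atom s) (BigAnd (Sts - {s}) (\<lambda>s'. Neg (Atom s')))))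
    (And (BigAnd Sts (\<lambda>s. Imp (Atom s) (And (Box l (Atom s)) (Box r (Atom s)))))
    (And (BigOr Al (\<lambda>\<alpha>. And (Atom \<alpha>) (BigAnd (Al - {\<alpha>}) (\<lambda>\<beta>. Neg (Atom \<beta>)))))
    (And (Imp (Or (Atom (start T)) (Atom void)) (Box d (Atom void)))
    (And (Imp (Atom (start T)) (Atom (blank T)))
         (BigAnd Al (\<lambda>\<alpha>. Imp (And (Neg (Atom pos)) (Atom \<alpha>)) (Box u (Atom \<alpha>)))))))))))"

definition psi_T :: "'x \<Rightarrow> 'x \<Rightarrow> 'x \<Rightarrow> 'p \<Rightarrow> ('p, 'p) tm \<Rightarrow> ('p, 'x) fm" where
  "psi_T l r u pos T =
    (let K = alphabet T \<times> states T;
         here = (\<lambda>(\<alpha>, s). And (Atom pos) (And (Atom s) (Atom \<alpha>))) in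
     And (BigAnd {c \<in> K. trans3 T c = MLeft} (\<lambda>c. Imp (here c) (Box u (Box l (Atom pos)))))
    (And (BigAnd {c \<in> K. trans3 T c = MRight} (\<lambda>c. Imp (here c) (Box u (Box r (Atom pos)))))
    (And (BigAnd {c \<in> K. trans3 T c = MRemain} (\<lambda>c. Imp (here c) (Box u (Atom pos))))
    (And (BigAnd K (\<lambda>c. Imp (here c) (Box u (Atom (trans2 T c)))))
         (BigAnd K (\<lambda>c. Imp (here c) (Box u (Atom (trans1 T c)))))))))"

definition phi_T ::
  "'x \<Rightarrow> 'x \<Rightarrow> 'x \<Rightarrow> 'x \<Rightarrow> 'x \<Rightarrow> 'p \<Rightarrow> 'p \<Rightarrow> 'p \<Rightarrow> 'p \<Rightarrow> ('p, 'p) tm \<Rightarrow> ('p, 'x) fm" where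
  "phi_T a l r u d void pos lpos rpos T =
     And (CK (psi_grid a l r u d))
    (And (CK (psi_sane l r u d void pos lpos rpos T))
    (And (CK (psi_T l r u pos T))
    (And (Atom (start T)) (Atom pos))))"

end

theory Submission
  imports Defs
begin

text \<open>
  \<open>psi_grid\<close> cannot force a grid, but it forces one up to indistinguishability in the fragment
  without arbitrary updates, as one sees by testing with updates that keep an \<open>a\<close>-arrow exactly at the
  worlds satisfying a given formula: the direction relations induce commuting bijections, pairwise inverse, on the
  set of theories of reachable worlds, hence an action of \<open>\<int> \<times> \<int>\<close>. This action may have nontrivial
  stabilisers, but pulling the labels back along it still gives a labelling of \<open>\<int> \<times> \<int>\<close>, whose rows
  \<open>0, 1, 2, \<dots>\<close> must be the successive configurations of the machine and whose negative rows are void.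
  Conversely, the genuine grid labelled by the run of the machine is a model of \<open>phi_T\<close>.
\<close>

section \<open>Derived connectives\<close>

declare sem.simps(6,7) [simp del]

lemma set_some_list: "finite I \<Longrightarrow> set (some_list I) = I"
  unfolding some_list_def by (rule someI2_ex[OF finite_distinct_list]) auto

lemma sem_derived [simp]:
  "sem M w (And \<phi> \<psi>) \<longleftrightarrow> sem M w \<phi> \<and> sem M w \<psi>"
  "sem M w (Imp \<phi> \<psi>) \<longleftrightarrow> (sem M w \<phi> \<longrightarrow> sem M w \<psi>)"
  "sem M w Top"
  "\<not> sem M w Bot"
  "sem M w (Dia x \<phi>) \<longleftrightarrow> (\<exists>v. (w, v) \<in> rel M x \<and> sem M v \<phi>)"
  by (auto simp: And_def Imp_def Top_def Bot_def Dia_def)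

lemma aulc_Top [simp]: "aulc Top"
  by (simp add: Top_def)

lemma sem_BigAnd [simp]: "finite I \<Longrightarrow> sem M w (BigAnd I f) \<longleftrightarrow> (\<forall>i\<in>I. sem M w (f i))"
proof -
  have "sem M w (foldr And (map f xs) Top) \<longleftrightarrow> (\<forall>i\<in>set xs. sem M w (f i))" for xs
    by (induction xs) auto
  then show "finite I \<Longrightarrow> ?thesis" by (simp add: BigAnd_def set_some_list)
qed

lemma sem_BigOr [simp]: "finite I \<Longrightarrow> sem M w (BigOr I f) \<longleftrightarrow> (\<exists>i\<in>I. sem M w (f i))"
proof -
  have "sem M w (foldr Or (map f xs) Bot) \<longleftrightarrow> (\<exists>i\<in>set xs. sem M w (f i))" for xs
    by (induction xs) auto
  then show "finite I \<Longrightarrow> ?thesis" by (simp add: BigOr_def set_some_list)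
qed

section \<open>Integer iterates of a bijection\<close>

text \<open>\<open>g\<close> stands for the inverse of \<open>f\<close>, but only on a set
  \<open>X\<close> that both preserve: the maps \<open>nxt x\<close> used later are shown to be
  mutually inverse on \<open>ths\<close> only.\<close>

definition int_pow :: "('b \<Rightarrow> 'b) \<Rightarrow> ('b \<Rightarrow> 'b) \<Rightarrow> int \<Rightarrow> 'b \<Rightarrow> 'b" where
  "int_pow f g i = (if 0 \<le> i then f ^^ nat i else g ^^ nat (- i))"

lemma int_pow_0 [simp]: "int_pow f g 0 x = x"
  by (simp add: int_pow_def)

lemma funpow_closed: "(\<And>x. x \<in> X \<Longrightarrow> f x \<in> X) \<Longrightarrow> x \<in> X \<Longrightarrow> (f ^^ n) x \<in> X"
  by (induction n) auto

lemma int_pow_closed: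
  assumes "\<And>x. x \<in> X \<Longrightarrow> f x \<in> X" "\<And>x. x \<in> X \<Longrightarrow> g x \<in> X" "x \<in> X"
  shows "int_pow f g i x \<in> X"
  using assms by (simp add: int_pow_def funpow_closed)

text \<open>For negative \<open>i\<close> the outermost \<open>g\<close> is cancelled by
  \<open>f\<close>; this needs the rest of the iterate to lie in \<open>X\<close>.\<close>

lemma int_pow_succ:
  assumes "\<And>x. x \<in> X \<Longrightarrow> g x \<in> X" "\<And>x. x \<in> X \<Longrightarrow> f (g x) = x" "x \<in> X"
  shows "f (int_pow f g i x) = int_pow f g (i + 1) x"
proof (cases "0 \<le> i")
  case True
  then have "nat (i + 1) = Suc (nat i)" by simp
  with True show ?thesis by (simp add: int_pow_def)
next
  case False
  then have "nat (- i) = Suc (nat (- (i + 1)))" by simp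
  with False assms show ?thesis
    by (auto simp: int_pow_def funpow_closed)
qed

lemma int_pow_swap: "int_pow f g i = int_pow g f (- i)"
  by (auto simp: int_pow_def)

lemma int_pow_pred:
  assumes "\<And>x. x \<in> X \<Longrightarrow> f x \<in> X" "\<And>x. x \<in> X \<Longrightarrow> g (f x) = x" "x \<in> X"
  shows "g (int_pow f g i x) = int_pow f g (i - 1) x"
  using int_pow_succ[of X f g x "- i"] assms by (simp add: int_pow_swap[of f g])

lemma int_pow_commute:
  assumes "\<And>x. x \<in> X \<Longrightarrow> f x \<in> X" "\<And>x. x \<in> X \<Longrightarrow> g x \<in> X" "x \<in> X"
    and "\<And>x. x \<in> X \<Longrightarrow> h (f x) = f (h x)" "\<And>x. x \<in> X \<Longrightarrow> h (g x) = g (h x)"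
  shows "h (int_pow f g i x) = int_pow f g i (h x)"
proof -
  have "h ((k ^^ n) x) = (k ^^ n) (h x)"
    if "\<And>x. x \<in> X \<Longrightarrow> k x \<in> X" "\<And>x. x \<in> X \<Longrightarrow> h (k x) = k (h x)" for k n
    using that assms(3) by (induction n) (auto simp: funpow_closed)
  with assms show ?thesis by (simp add: int_pow_def)
qed

section \<open>Theories of reachable worlds\<close>

text \<open>The points \<open>e i j\<close> need neither be distinct nor be joined by arrows. Boxes
  merely behave as on a grid, and only for formulas without arbitrary updates.\<close>

definition grid_map ::
  "('w, 'p, 'x) model \<Rightarrow> 'x \<Rightarrow> 'x \<Rightarrow> 'x \<Rightarrow> 'x \<Rightarrow> (int \<Rightarrow> int \<Rightarrow> 'w) \<Rightarrow> bool" where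
  "grid_map M l r u d e \<longleftrightarrow> (\<forall>i j \<phi>. aulc \<phi> \<longrightarrow>
     (sem M (e i j) (Box l \<phi>) \<longleftrightarrow> sem M (e (i - 1) j) \<phi>) \<and>
     (sem M (e i j) (Box r \<phi>) \<longleftrightarrow> sem M (e (i + 1) j) \<phi>) \<and>
     (sem M (e i j) (Box u \<phi>) \<longleftrightarrow> sem M (e i (j + 1)) \<phi>) \<and>
     (sem M (e i j) (Box d \<phi>) \<longleftrightarrow> sem M (e i (j - 1)) \<phi>))"

text \<open>Restricted to \<open>aulc\<close> formulas because only these may occur in the updates
  over which \<open>All\<close> ranges.\<close>

definition th :: "('w, 'p, 'x) model \<Rightarrow> 'w \<Rightarrow> ('p, 'x) fm set" where
  "th M v = {\<chi>. aulc \<chi> \<and> sem M v \<chi>}"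

text \<open>One inclusion suffices: theories are complete, so the converse follows by applying it to
  negations.\<close>

lemma th_eqI:
  assumes "\<And>\<chi>. aulc \<chi> \<Longrightarrow> sem M v \<chi> \<Longrightarrow> sem M v' \<chi>"
  shows "th M v = th M v'"
  using assms[of "Neg _"] assms by (fastforce simp: th_def)

text \<open>A direction may lead to many worlds, but by \<open>th_dir\<close> all of them have the
  same theory. Passing to theories thus turns the relation into a function.\<close>

definition nxt :: "'x \<Rightarrow> ('p, 'x) fm set \<Rightarrow> ('p, 'x) fm set" where
  "nxt x \<Theta> = {\<chi>. Box x \<chi> \<in> \<Theta>}"

section \<open>Testing theories by arrow updates\<close>

locale grid_model =
  fixes M :: "('w, 'p, 'x::finite) model" and w0 :: 'w and a l r u d :: 'x
  assumes agents: "distinct [a, l, r, u, d]"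
    and grid: "sem M w0 (CK (psi_grid a l r u d))"
begin

definition reach :: "'w set" where
  "reach = {v. (w0, v) \<in> (\<Union>x. rel M x)\<^sup>*}"

definition ths :: "('p, 'x) fm set set" where
  "ths = th M ` reach"

lemma reach_root: "w0 \<in> reach"
  by (simp add: reach_def)

lemma reach_step: "v \<in> reach \<Longrightarrow> (v, v') \<in> rel M x \<Longrightarrow> v' \<in> reach"
  unfolding reach_def by (auto intro: rtrancl_into_rtrancl)

lemma grid_at: "v \<in> reach \<Longrightarrow> sem M v (psi_grid a l r u d)"
  using grid by (simp add: reach_def)

text \<open>All direction arrows survive, and an \<open>a\<close>-arrow survives exactly when it
  leaves a world satisfying \<chi>. Hence \<open>Dia a Top\<close> evaluated here acts as a name for
  \<chi>, see \<open>test_Dia_a\<close>.\<close>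

definition test :: "('p, 'x) fm \<Rightarrow> ('w, 'p, 'x) model" where
  "test \<chi> = M\<lparr>rel := \<lambda>x. {(v, v'). (v, v') \<in> rel M x \<and> (x \<in> {l, r, u, d} \<or> x = a \<and> sem M v \<chi>)}\<rparr>"

lemma sem_All_test:
  assumes "sem M v (All \<phi>)" "aulc \<chi>"
  shows "sem (test \<chi>) v \<phi>"
proof -
  let ?U = "{|(Top, l, Top), (Top, r, Top), (Top, u, Top), (Top, d, Top), (\<chi>, a, Top)|}"
  have "aulc_update ?U"
    using assms(2) by (auto simp: aulc_update_def)
  with assms(1) have "sem M v (Upd ?U \<phi>)"
    by (simp add: sem.simps(7))
  moreover have "(\<lambda>x. {(w1, w2). (w1, w2) \<in> rel M x \<and>
            (\<exists>(\<phi>1, y, \<phi>2) \<in> fset ?U. y = x \<and> sem M w1 \<phi>1 \<and> sem M w2 \<phi>2)})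
     = (\<lambda>x. {(v, v'). (v, v') \<in> rel M x \<and> (x \<in> {l, r, u, d} \<or> x = a \<and> sem M v \<chi>)})"
    by (auto simp: fun_eq_iff)
  ultimately show ?thesis
    unfolding test_def by (simp only: sem.simps(6))
qed

lemma rel_test:
  "x \<in> {l, r, u, d} \<Longrightarrow> rel (test \<chi>) x = rel M x"
  "rel (test \<chi>) a = {(v, v') \<in> rel M a. sem M v \<chi>}"
  using agents by (auto simp: test_def)

lemma ref_a_ex: "v \<in> reach \<Longrightarrow> \<exists>v'. (v, v') \<in> rel M a"
  using grid_at[of v] by (auto simp: psi_grid_def ref_a_def simp del: sem.simps)

lemma test_Dia_a: "v \<in> reach \<Longrightarrow> sem (test \<chi>) v (Dia a Top) \<longleftrightarrow> sem M v \<chi>"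
  using ref_a_ex[of v] by (auto simp: rel_test)

lemma direction_at:
  assumes "v \<in> reach" "x \<in> {l, r, u, d}"
  shows "sem M v (And (Dia x Top) (All (Imp (Dia x (Dia a Top)) (Box x (Dia a Top)))))"
proof -
  have "sem M v (direction a l r u d)"
    using grid_at[OF assms(1)] by (simp add: psi_grid_def del: sem.simps)
  moreover have fin: "finite {l, r, u, d}" by simp
  ultimately have "\<forall>x\<in>{l, r, u, d}. sem M v (And (Dia x Top) (All (Imp (Dia x (Dia a Top)) (Box x (Dia a Top)))))"
    unfolding direction_def sem_BigAnd[OF fin] by blast
  with assms(2) show ?thesis by blast
qed

text \<open>Each quantified conjunct of \<open>psi_grid\<close> is instantiated with the test
  update. With \<open>Dia a Top\<close> read as \<chi>, these become schemes about an arbitrary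
  \<open>aulc\<close> formula.\<close>

lemma test_grid:
  assumes "v \<in> reach" "aulc \<chi>"
  shows "sem (test \<chi>) v (Box a (Dia a Top))"
    and "x \<in> {l, r, u, d} \<Longrightarrow> sem (test \<chi>) v (Imp (Dia x (Dia a Top)) (Box x (Dia a Top)))"
    and "(x, y) \<in> INV l r u d \<Longrightarrow> sem (test \<chi>) v (Imp (Dia a Top) (Box x (Box y (Dia a Top))))"
    and "(x, y) \<in> COMM l r u d \<Longrightarrow>
      sem (test \<chi>) v (Imp (Dia x (Dia y (Dia a Top))) (Box y (Box x (Dia a Top))))"
proof -
  note at = grid_at[OF assms(1), unfolded psi_grid_def ref_a_def inverse_fm_def commute_def sem_derived(1)]
  note all = sem_All_test[OF _ assms(2)]
  show "sem (test \<chi>) v (Box a (Dia a Top))"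
    using at all by blast
  show "sem (test \<chi>) v (Imp (Dia x (Dia a Top)) (Box x (Dia a Top)))" if "x \<in> {l, r, u, d}"
    using direction_at[OF assms(1) that] all unfolding sem_derived(1) by blast
  have fin: "finite (INV l r u d)" "finite (COMM l r u d)"
    by (auto simp: INV_def COMM_def)
  have "sem (test \<chi>) v (Imp (Dia a Top) (BigAnd (INV l r u d) (\<lambda>(x, y). Box x (Box y (Dia a Top)))))"
    using at all by blast
  then show "sem (test \<chi>) v (Imp (Dia a Top) (Box x (Box y (Dia a Top))))" if "(x, y) \<in> INV l r u d"
    using that unfolding sem_derived(2) sem_BigAnd[OF fin(1)] by fast
  have "sem (test \<chi>) v (BigAnd (COMM l r u d)
      (\<lambda>(x, y). Imp (Dia x (Dia y (Dia a Top))) (Box y (Box x (Dia a Top)))))"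
    using at all by blast
  then show "sem (test \<chi>) v (Imp (Dia x (Dia y (Dia a Top))) (Box y (Box x (Dia a Top))))"
    if "(x, y) \<in> COMM l r u d"
    using that unfolding sem_BigAnd[OF fin(2)] by fast
qed

text \<open>If \<chi> holds at \<open>v\<close>, the arrow to \<open>v'\<close> survives the test,
  so \<open>ref_a\<close> demands a surviving \<open>a\<close>-arrow at \<open>v'\<close>, which
  means that \<chi> holds there.\<close>

lemma th_a:
  assumes "v \<in> reach" "(v, v') \<in> rel M a"
  shows "th M v' = th M v"
proof (rule sym, rule th_eqI)
  fix \<chi> :: "('p, 'x) fm" assume \<chi>: "aulc \<chi>" "sem M v \<chi>"
  have "(v, v') \<in> rel (test \<chi>) a"
    using assms(2) \<chi>(2) by (simp add: rel_test)
  then have "sem (test \<chi>) v' (Dia a Top)"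
    using test_grid(1)[OF assms(1) \<chi>(1)] by (metis sem.simps(4))
  then show "sem M v' \<chi>"
    using test_Dia_a reach_step assms by blast
qed

lemma dir_ex: "v \<in> reach \<Longrightarrow> x \<in> {l, r, u, d} \<Longrightarrow> \<exists>v'\<in>reach. (v, v') \<in> rel M x"
  using direction_at[of v x] reach_step unfolding sem_derived(1,5) by blast

lemma dir_unique:
  assumes "v \<in> reach" "x \<in> {l, r, u, d}" "(v, v1) \<in> rel M x" "(v, v2) \<in> rel M x"
  shows "th M v1 = th M v2"
proof (rule th_eqI)
  fix \<chi> :: "('p, 'x) fm" assume \<chi>: "aulc \<chi>" "sem M v1 \<chi>"
  have "sem (test \<chi>) v (Imp (Dia x (Dia a Top)) (Box x (Dia a Top)))"
    using test_grid(2) assms \<chi>(1) by blast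
  moreover have "sem (test \<chi>) v1 (Dia a Top)"
    using test_Dia_a reach_step assms \<chi>(2) by blast
  ultimately have "sem (test \<chi>) v2 (Dia a Top)"
    using assms(3,4) unfolding sem_derived(2) sem_derived(5)[of _ _ x] sem.simps(4) rel_test(1)[OF assms(2)]
    by blast
  then show "sem M v2 \<chi>"
    using test_Dia_a reach_step assms by blast
qed

text \<open>All \<open>x\<close>-successors of \<open>v\<close> agree on \<chi>, and
  \<open>v'\<close> is one of them, so the box at \<open>v\<close> says no more than \<chi> at
  \<open>v'\<close>.\<close>

lemma th_dir:
  assumes "v \<in> reach" "x \<in> {l, r, u, d}" "(v, v') \<in> rel M x"
  shows "th M v' = nxt x (th M v)"
proof -
  have "sem M v' \<chi> \<longleftrightarrow> (\<forall>v2. (v, v2) \<in> rel M x \<longrightarrow> sem M v2 \<chi>)" if "aulc \<chi>" for \<chi>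
    using dir_unique[OF assms(1,2,3)] assms(3) that unfolding th_def by blast
  then show ?thesis
    by (auto simp: th_def nxt_def)
qed

lemma ths_nxt: "\<Theta> \<in> ths \<Longrightarrow> x \<in> {l, r, u, d} \<Longrightarrow> nxt x \<Theta> \<in> ths"
  unfolding ths_def using dir_ex th_dir by (smt (verit) image_iff)

text \<open>Walk along \<open>x\<close> and then \<open>y\<close> to some \<open>v2\<close>. The
  test of \<open>inverse_fm\<close> carries every \<chi> true at \<open>v\<close> to
  \<open>v2\<close>, although \<open>v2\<close> may differ from \<open>v\<close>.\<close>

lemma nxt_inverse:
  assumes "\<Theta> \<in> ths" "(x, y) \<in> INV l r u d"
  shows "nxt y (nxt x \<Theta>) = \<Theta>"
proof -
  obtain v where v: "v \<in> reach" "\<Theta> = th M v"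
    using assms(1) by (auto simp: ths_def)
  have xy: "x \<in> {l, r, u, d}" "y \<in> {l, r, u, d}"
    using assms(2) by (auto simp: INV_def)
  obtain v1 v2 where v12: "v1 \<in> reach" "(v, v1) \<in> rel M x" "v2 \<in> reach" "(v1, v2) \<in> rel M y"
    using dir_ex v xy by meson
  have "th M v = th M v2"
  proof (rule th_eqI)
    fix \<chi> :: "('p, 'x) fm" assume \<chi>: "aulc \<chi>" "sem M v \<chi>"
    have "sem (test \<chi>) v (Box x (Box y (Dia a Top)))"
      using test_grid(3)[OF v(1) \<chi>(1) assms(2)] test_Dia_a[OF v(1)] \<chi>(2) unfolding sem_derived(2) by blast
    then have "sem (test \<chi>) v2 (Dia a Top)"
      using v12 unfolding sem.simps(4) rel_test(1)[OF xy(1)] rel_test(1)[OF xy(2)] by blast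
    then show "sem M v2 \<chi>"
      using test_Dia_a v12 by blast
  qed
  with th_dir v v12 xy show ?thesis by metis
qed

text \<open>The two orders of walking may end at different worlds \<open>v2\<close> and
  \<open>v4\<close>; the test of \<open>commute\<close> carries every \<chi> from \<open>v2\<close>
  to \<open>v4\<close>.\<close>

lemma nxt_commute:
  assumes "\<Theta> \<in> ths" "(x, y) \<in> COMM l r u d"
  shows "nxt y (nxt x \<Theta>) = nxt x (nxt y \<Theta>)"
proof -
  obtain v where v: "v \<in> reach" "\<Theta> = th M v"
    using assms(1) by (auto simp: ths_def)
  have xy: "x \<in> {l, r, u, d}" "y \<in> {l, r, u, d}"
    using assms(2) by (auto simp: COMM_def)
  obtain v1 v2 where v12: "v1 \<in> reach" "(v, v1) \<in> rel M x" "v2 \<in> reach" "(v1, v2) \<in> rel M y"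
    using dir_ex v xy by meson
  obtain v3 v4 where v34: "v3 \<in> reach" "(v, v3) \<in> rel M y" "v4 \<in> reach" "(v3, v4) \<in> rel M x"
    using dir_ex v xy by meson
  have "th M v2 = th M v4"
  proof (rule th_eqI)
    fix \<chi> :: "('p, 'x) fm" assume \<chi>: "aulc \<chi>" "sem M v2 \<chi>"
    have "sem (test \<chi>) v (Imp (Dia x (Dia y (Dia a Top))) (Box y (Box x (Dia a Top))))"
      using test_grid(4)[OF v(1) \<chi>(1) assms(2)] .
    moreover have "sem (test \<chi>) v2 (Dia a Top)"
      using test_Dia_a v12 \<chi>(2) by blast
    then have "sem (test \<chi>) v (Dia x (Dia y (Dia a Top)))"
      using v12 unfolding sem_derived(5)[of _ _ x] sem_derived(5)[of _ _ y] rel_test(1)[OF xy(1)] rel_test(1)[OF xy(2)]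
      by blast
    ultimately have "sem (test \<chi>) v4 (Dia a Top)"
      using v34 unfolding sem_derived(2) sem.simps(4) rel_test(1)[OF xy(1)] rel_test(1)[OF xy(2)] by blast
    then show "sem M v4 \<chi>"
      using test_Dia_a v34 by blast
  qed
  with th_dir v v12 v34 xy show ?thesis by metis
qed

lemma no_other_step:
  assumes "v \<in> reach" "(v, v') \<in> rel M x"
  shows "x \<in> {l, r, u, d, a}"
proof (rule ccontr)
  assume "x \<notin> {l, r, u, d, a}"
  then have "sem M v (Box x Bot)"
    using grid_at[OF assms(1)] by (simp add: psi_grid_def no_other_def del: sem.simps)
  with assms(2) show False by auto
qed

text \<open>The grid is the orbit of the theory of \<open>w0\<close> under the four maps
  \<open>nxt x\<close>, with a representative world chosen at each point. The last conclusion lets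
  statements about all reachable worlds be read off the grid.\<close>

lemma grid_map_ex:
  obtains e where "grid_map M l r u d e" "e 0 0 = w0" "\<And>i j. e i j \<in> reach"
    "\<And>v. v \<in> reach \<Longrightarrow> \<exists>i j. th M v = th M (e i j)"
proof -
  define \<Theta> where "\<Theta> i j = int_pow (nxt r) (nxt l) i (int_pow (nxt u) (nxt d) j (th M w0))" for i j
  have root: "th M w0 \<in> ths"
    by (simp add: ths_def reach_root)
  have closed: "nxt l \<Psi> \<in> ths" "nxt r \<Psi> \<in> ths" "nxt u \<Psi> \<in> ths" "nxt d \<Psi> \<in> ths" if "\<Psi> \<in> ths" for \<Psi>
    using that ths_nxt by auto
  have inv: "nxt r (nxt l \<Psi>) = \<Psi>" "nxt l (nxt r \<Psi>) = \<Psi>" "nxt u (nxt d \<Psi>) = \<Psi>" "nxt d (nxt u \<Psi>) = \<Psi>"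
    if "\<Psi> \<in> ths" for \<Psi>
    using nxt_inverse[OF that] by (auto simp: INV_def)
  have comm: "nxt u (nxt r \<Psi>) = nxt r (nxt u \<Psi>)" "nxt u (nxt l \<Psi>) = nxt l (nxt u \<Psi>)"
    "nxt d (nxt r \<Psi>) = nxt r (nxt d \<Psi>)" "nxt d (nxt l \<Psi>) = nxt l (nxt d \<Psi>)" if "\<Psi> \<in> ths" for \<Psi>
    using nxt_commute[OF that] by (auto simp: COMM_def)
  have col: "int_pow (nxt u) (nxt d) j (th M w0) \<in> ths" for j
    by (intro int_pow_closed closed root)
  have \<Theta>_ths: "\<Theta> i j \<in> ths" for i j
    unfolding \<Theta>_def by (intro int_pow_closed closed col)
  have R: "nxt r (\<Theta> i j) = \<Theta> (i + 1) j" for i j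
    unfolding \<Theta>_def by (rule int_pow_succ[of ths]) (simp_all add: closed inv col)
  have L: "nxt l (\<Theta> i j) = \<Theta> (i - 1) j" for i j
    unfolding \<Theta>_def by (rule int_pow_pred[of ths]) (simp_all add: closed inv col)
  \<comment> \<open>Vertical iterates are applied first, so a vertical map must be commuted past the
    horizontal iterate before it can extend the column.\<close>
  have U: "nxt u (\<Theta> i j) = \<Theta> i (j + 1)" for i j
    unfolding \<Theta>_def
    by (subst int_pow_commute[of ths], (simp_all add: closed comm col)[5],
        subst int_pow_succ[of ths]) (simp_all add: closed inv root)
  have D: "nxt d (\<Theta> i j) = \<Theta> i (j - 1)" for i j
    unfolding \<Theta>_def
    by (subst int_pow_commute[of ths], (simp_all add: closed comm col)[5],
        subst int_pow_pred[of ths]) (simp_all add: closed inv root)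
  \<comment> \<open>The origin is fixed by hand, since the choice could return another world with
    the theory of \<open>w0\<close>.\<close>
  define e where "e i j = (if i = 0 \<and> j = 0 then w0 else SOME v. v \<in> reach \<and> th M v = \<Theta> i j)" for i j
  have e: "e i j \<in> reach \<and> th M (e i j) = \<Theta> i j" for i j
  proof (cases "i = 0 \<and> j = 0")
    case True
    then show ?thesis by (simp add: e_def reach_root \<Theta>_def)
  next
    case False
    have "\<exists>v. v \<in> reach \<and> th M v = \<Theta> i j"
      using \<Theta>_ths[of i j] by (auto simp: ths_def)
    from someI_ex[OF this] False show ?thesis by (auto simp: e_def)
  qed
  have e_sem: "sem M (e i j) \<phi> \<longleftrightarrow> \<phi> \<in> \<Theta> i j" if "aulc \<phi>" for i j \<phi>
    using that e[of i j] by (auto simp: th_def)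
  have "grid_map M l r u d e"
    unfolding grid_map_def
    by (auto simp del: sem.simps simp: e_sem L[symmetric] R[symmetric] U[symmetric] D[symmetric] nxt_def)
  \<comment> \<open>Along a path from \<open>w0\<close>, an \<open>a\<close>-step keeps the theory
    and a direction step moves to a neighbouring grid point; \<open>no_other\<close> excludes
    further steps.\<close>
  moreover have "\<exists>i j. th M v = \<Theta> i j" if "v \<in> reach" for v
  proof -
    from that have "(w0, v) \<in> (\<Union>x. rel M x)\<^sup>*" by (simp add: reach_def)
    then show ?thesis
    proof (induction rule: rtrancl_induct)
      case base
      have "th M w0 = \<Theta> 0 0" by (simp add: \<Theta>_def)
      then show ?case by blast
    next
      case (step y z)
      then obtain i j x where *: "th M y = \<Theta> i j" "(y, z) \<in> rel M x" "y \<in> reach"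
        by (auto simp: reach_def)
      from no_other_step[OF *(3,2)] consider "x = a" | "x \<in> {l, r, u, d}" by auto
      then show ?case
      proof cases
        case 1
        with * th_a show ?thesis by metis
      next
        case 2
        with * have "th M z = nxt x (\<Theta> i j)" by (simp add: th_dir)
        with 2 L R U D show ?thesis by auto blast+
      qed
    qed
  qed
  ultimately show ?thesis
    using that[of e] e by (auto simp: e_def)
qed

end

section \<open>Labelled grids\<close>

text \<open>The meaning of \<open>psi_sane\<close> once boxes are read as steps on the grid:
  \<open>i\<close> is the tape position and \<open>j\<close> the time.\<close>

definition sane_labels ::
  "'p \<Rightarrow> 'p \<Rightarrow> 'p \<Rightarrow> 'p \<Rightarrow> ('p, 'p) tm \<Rightarrow> (int \<Rightarrow> int \<Rightarrow> 'p \<Rightarrow> bool) \<Rightarrow> int \<Rightarrow> int \<Rightarrow> bool" where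
  "sane_labels void pos lpos rpos T L i j \<longleftrightarrow>
     \<not> (L i j pos \<and> L i j lpos) \<and> \<not> (L i j pos \<and> L i j rpos) \<and> \<not> (L i j rpos \<and> L i j lpos) \<and>
     (L i j pos \<or> L i j rpos \<longrightarrow> L (i + 1) j rpos) \<and>
     (L i j pos \<or> L i j lpos \<longrightarrow> L (i - 1) j lpos) \<and>
     (\<exists>s \<in> states T \<union> {void}. L i j s \<and> (\<forall>s' \<in> states T \<union> {void} - {s}. \<not> L i j s')) \<and>
     (\<forall>s \<in> states T \<union> {void}. L i j s \<longrightarrow> L (i - 1) j s \<and> L (i + 1) j s) \<and>
     (\<exists>\<alpha> \<in> alphabet T. L i j \<alpha> \<and> (\<forall>\<beta> \<in> alphabet T - {\<alpha>}. \<not> L i j \<beta>)) \<and>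
     (L i j (start T) \<or> L i j void \<longrightarrow> L i (j - 1) void) \<and>
     (L i j (start T) \<longrightarrow> L i j (blank T)) \<and>
     (\<forall>\<alpha> \<in> alphabet T. \<not> L i j pos \<and> L i j \<alpha> \<longrightarrow> L i (j + 1) \<alpha>)"

definition run_labels ::
  "'p \<Rightarrow> ('p, 'p) tm \<Rightarrow> (int \<Rightarrow> int \<Rightarrow> 'p \<Rightarrow> bool) \<Rightarrow> int \<Rightarrow> int \<Rightarrow> bool" where
  "run_labels pos T L i j \<longleftrightarrow>
     (\<forall>\<alpha> \<in> alphabet T. \<forall>s \<in> states T. L i j pos \<and> L i j s \<and> L i j \<alpha> \<longrightarrow>
        L (move_head (trans3 T (\<alpha>, s)) i) (j + 1) pos \<and>
        L i (j + 1) (trans2 T (\<alpha>, s)) \<and> L i (j + 1) (trans1 T (\<alpha>, s)))"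

lemma grid_map_Box:
  assumes "grid_map M l r u d e" "aulc \<phi>"
  shows "sem M (e i j) (Box l \<phi>) \<longleftrightarrow> sem M (e (i - 1) j) \<phi>"
    "sem M (e i j) (Box r \<phi>) \<longleftrightarrow> sem M (e (i + 1) j) \<phi>"
    "sem M (e i j) (Box u \<phi>) \<longleftrightarrow> sem M (e i (j + 1)) \<phi>"
    "sem M (e i j) (Box d \<phi>) \<longleftrightarrow> sem M (e i (j - 1)) \<phi>"
  using assms by (simp_all add: grid_map_def del: sem.simps)

lemma sem_psi_sane:
  assumes "grid_map M l r u d e" "turing_machine T"
  shows "sem M (e i j) (psi_sane l r u d void pos lpos rpos T) \<longleftrightarrow>
    sane_labels void pos lpos rpos T (\<lambda>i j p. e i j \<in> val M p) i j"
proof -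
  have "finite (states T)" "finite (alphabet T)"
    using assms(2) by (auto simp: turing_machine_def)
  then show ?thesis
    unfolding psi_sane_def sane_labels_def Let_def
    by (simp del: sem.simps(4) Un_insert_right add: grid_map_Box[OF assms(1)])
qed

lemma sem_psi_T:
  assumes "grid_map M l r u d e" "turing_machine T"
  shows "sem M (e i j) (psi_T l r u pos T) \<longleftrightarrow> run_labels pos T (\<lambda>i j p. e i j \<in> val M p) i j"
proof -
  have fin: "finite (alphabet T \<times> states T)"
    using assms(2) by (auto simp: turing_machine_def)
  \<comment> \<open>Merges the three conjuncts of \<open>psi_T\<close> for the head moves into the
    single statement with \<open>move_head\<close>.\<close>
  have move: "e (move_head m i) (j + 1) \<in> val M pos \<longleftrightarrow>
      (m = MLeft \<longrightarrow> e (i - 1) (j + 1) \<in> val M pos) \<and> (m = MRight \<longrightarrow> e (i + 1) (j + 1) \<in> val M pos) \<and>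
      (m = MRemain \<longrightarrow> e i (j + 1) \<in> val M pos)" for m
    by (cases m) auto
  have sem_filter: "sem M w (BigAnd {c \<in> K. Q c} (\<lambda>c. Imp (g c) \<chi>)) \<longleftrightarrow>
      (\<forall>c\<in>K. sem M w (g c) \<longrightarrow> Q c \<longrightarrow> sem M w \<chi>)"
    if "finite K" for w Q g \<chi> and K :: "('b \<times> 'b) set"
  proof -
    have "finite {c \<in> K. Q c}" using that by simp
    then show ?thesis by auto
  qed
  let ?here = "\<lambda>(\<alpha>, s). And (Atom pos) (And (Atom s) (Atom \<alpha>))"
  have "sem M (e i j) (psi_T l r u pos T) \<longleftrightarrow>
    (\<forall>c\<in>alphabet T \<times> states T. sem M (e i j) (?here c) \<longrightarrow>
      e (move_head (trans3 T c) i) (j + 1) \<in> val M pos \<and>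
      e i (j + 1) \<in> val M (trans2 T c) \<and> e i (j + 1) \<in> val M (trans1 T c))"
    unfolding psi_T_def Let_def move sem_derived(1) sem_filter[OF fin] sem_BigAnd[OF fin] sem_derived(2) ball_conj_distrib
      imp_conjR
    by (simp only: grid_map_Box[OF assms(1)] aulc.simps sem.simps(1) conj_assoc)
  then show ?thesis
    by (auto simp: run_labels_def)
qed

section \<open>Recovering the run from a labelled grid\<close>

abbreviation config_at :: "('l, 's) tm \<Rightarrow> nat \<Rightarrow> ('l, 's) config" where
  "config_at T n \<equiv> (step T ^^ n) (init_config T)"

lemma config_at_wf:
  assumes "turing_machine T" "config_at T n = (s, h, t)"
  shows "s \<in> states T \<and> (\<forall>i. t i \<in> alphabet T)"
  using assms(2)
proof (induction n arbitrary: s h t)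
  case 0
  with assms(1) show ?case by (auto simp: init_config_def turing_machine_def)
next
  case (Suc n)
  obtain s' h' t' where c: "config_at T n = (s', h', t')" by (metis prod.exhaust)
  with Suc.IH have wf: "s' \<in> states T" "\<forall>i. t' i \<in> alphabet T" by auto
  then have "(t' h', s') \<in> alphabet T \<times> states T" by simp
  then have "trans1 T (t' h', s') \<in> alphabet T \<and> trans2 T (t' h', s') \<in> states T"
    using assms(1) unfolding turing_machine_def by blast
  with Suc.prems c wf show ?case by auto
qed

context
  fixes T :: "('p, 'p) tm" and void pos lpos rpos :: 'p and L :: "int \<Rightarrow> int \<Rightarrow> 'p \<Rightarrow> bool"
  assumes T: "turing_machine T" and void: "void \<notin> states T"
    and sane: "\<And>i j. sane_labels void pos lpos rpos T L i j"
    and run: "\<And>i j. run_labels pos T L i j"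
    and root: "L 0 0 (start T)" "L 0 0 pos"
begin

lemma labels:
  "L i j pos \<Longrightarrow> L (i + 1) j rpos" "L i j rpos \<Longrightarrow> L (i + 1) j rpos"
  "L i j pos \<Longrightarrow> L (i - 1) j lpos" "L i j lpos \<Longrightarrow> L (i - 1) j lpos"
  "L i j pos \<Longrightarrow> \<not> L i j lpos" "L i j pos \<Longrightarrow> \<not> L i j rpos"
  "L i j (start T) \<Longrightarrow> L i (j - 1) void" "L i j void \<Longrightarrow> L i (j - 1) void"
  "L i j (start T) \<Longrightarrow> L i j (blank T)"
  using sane[of i j] unfolding sane_labels_def by (elim conjE; metis)+

lemma row_state:
  assumes "L i j s" "s \<in> states T \<union> {void}"
  shows "L i' j s"
proof -
  have step: "L (i - 1) j s \<and> L (i + 1) j s" if "L i j s" for i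
  proof -
    have "\<forall>s \<in> states T \<union> {void}. L i j s \<longrightarrow> L (i - 1) j s \<and> L (i + 1) j s"
      using sane[of i j] unfolding sane_labels_def by (elim conjE)
    with assms(2) that show ?thesis by auto
  qed
  show ?thesis
  proof (induction i' rule: int_induct[where k = i])
    case base
    show ?case by (fact assms(1))
  next
    case (step1 i)
    show ?case using step[OF step1(2)] by (rule conjunct2)
  next
    case (step2 i)
    show ?case using step[OF step2(2)] by (rule conjunct1)
  qed
qed

lemma state_unique:
  assumes "L i j s" "L i j s'" "s \<in> states T \<union> {void}" "s' \<in> states T \<union> {void}"
  shows "s = s'"
proof -
  have "\<exists>s \<in> states T \<union> {void}. L i j s \<and> (\<forall>s' \<in> states T \<union> {void} - {s}. \<not> L i j s')"
    using sane[of i j] unfolding sane_labels_def by (elim conjE)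
  with assms show ?thesis by (metis Diff_iff singletonD)
qed

lemma symbol_up:
  assumes "\<alpha> \<in> alphabet T" "\<not> L i j pos" "L i j \<alpha>"
  shows "L i (j + 1) \<alpha>"
proof -
  have "\<forall>\<alpha> \<in> alphabet T. \<not> L i j pos \<and> L i j \<alpha> \<longrightarrow> L i (j + 1) \<alpha>"
    using sane[of i j] unfolding sane_labels_def by (elim conjE)
  with assms show ?thesis by simp
qed

text \<open>A head mark forces \<open>rpos\<close> on everything to its right and
  \<open>lpos\<close> on everything to its left, and both exclude \<open>pos\<close>. So a row
  containing the head cannot be periodic, even if the underlying theories could otherwise
  repeat.\<close>

lemma pos_unique:
  assumes "L h j pos" "i \<noteq> h"
  shows "\<not> L i j pos"
proof -
  have right: "L (h + 1 + int k) j rpos" for k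
  proof (induction k)
    case 0
    then show ?case using labels(1)[OF assms(1)] by simp
  next
    case (Suc k)
    from labels(2)[OF this] show ?case by (simp add: add_ac)
  qed
  have left: "L (h - 1 - int k) j lpos" for k
  proof (induction k)
    case 0
    then show ?case using labels(3)[OF assms(1)] by simp
  next
    case (Suc k)
    from labels(4)[OF this] show ?case by (simp add: algebra_simps)
  qed
  have "L i j rpos \<or> L i j lpos"
    using right[of "nat (i - h - 1)"] left[of "nat (h - 1 - i)"] assms(2) by (cases "i > h") auto
  with labels(5,6)[of i j] show ?thesis by blast
qed

text \<open>Induction on time. At the head, \<open>run_labels\<close> writes the new symbol and
  state; all other cells copy their symbol upwards, being unmarked by \<open>pos_unique\<close>; the
  state then spreads along the row.\<close>

lemma row_encodes:
  assumes "config_at T n = (s, h, t)"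
  shows "L i (int n) s \<and> L i (int n) (t i) \<and> L h (int n) pos"
  using assms
proof (induction n arbitrary: s h t i)
  case 0
  have start: "L i 0 (start T)" for i
    using row_state[OF root(1)] T by (auto simp: turing_machine_def)
  then have "L i 0 (blank T)" for i
    by (rule labels(9))
  with 0 start root show ?case by (auto simp: init_config_def)
next
  case (Suc n)
  obtain s' h' t' where c: "config_at T n = (s', h', t')" by (metis prod.exhaust)
  note IH = Suc.IH[OF c]
  have wf: "s' \<in> states T" "\<And>i. t' i \<in> alphabet T"
    using config_at_wf[OF T c] by auto
  have new: "L (move_head (trans3 T (t' h', s')) h') (int n + 1) pos"
      "L h' (int n + 1) (trans2 T (t' h', s'))" "L h' (int n + 1) (trans1 T (t' h', s'))"
    using run[of h' "int n"] IH[of h'] wf unfolding run_labels_def by blast+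
  have eq: "s = trans2 T (t' h', s')" "h = move_head (trans3 T (t' h', s')) h'"
      "t = t'(h' := trans1 T (t' h', s'))"
    using Suc.prems c by auto
  have "L i (int n + 1) (t i)"
  proof (cases "i = h'")
    case False
    then have "\<not> L i (int n) pos"
      using pos_unique IH by blast
    then have "L i (int n + 1) (t' i)"
      using symbol_up IH[of i] wf by blast
    with False eq show ?thesis by simp
  qed (use new eq in simp)
  moreover have "L i (int n + 1) s"
    using row_state new(2) eq config_at_wf[OF T Suc.prems] by blast
  ultimately show ?case
    using new(1) eq by (simp add: add_ac)
qed

lemma row_void: "L i (- 1 - int n) void"
proof (induction n)
  case 0
  have "L i 0 (start T)"
    using row_state[OF root(1)] T by (auto simp: turing_machine_def)
  then show ?case using labels(7)[of i 0] by simp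
next
  case (Suc n)
  from labels(8)[OF this] show ?case by (simp add: algebra_simps)
qed

text \<open>Rows from 0 on carry only the state of their configuration, and rows below 0 only
  \<open>void\<close>, so the final state cannot appear except through the run.\<close>

lemma final_label_iff_halts: "(\<exists>i j. L i j (final T)) \<longleftrightarrow> halts T"
proof
  assume "halts T"
  then obtain n where "fst (config_at T n) = final T" by (auto simp: halts_def)
  then have "L 0 (int n) (final T)"
    using row_encodes[of n] by (metis prod.collapse)
  then show "\<exists>i j. L i j (final T)" by blast
next
  assume "\<exists>i j. L i j (final T)"
  then obtain i j where ij: "L i j (final T)" by blast
  have final: "final T \<in> states T" using T by (simp add: turing_machine_def)
  show "halts T"
  proof (cases "0 \<le> j")
    case True
    then obtain n where n: "j = int n" by (metis nonneg_int_cases)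
    obtain s h t where c: "config_at T n = (s, h, t)" by (metis prod.exhaust)
    have "s = final T"
      using state_unique[of i j] row_encodes[OF c] config_at_wf[OF T c] ij n final by blast
    with c show ?thesis by (auto simp: halts_def intro!: exI[of _ n])
  next
    case False
    then have "L i j void"
      using row_void[of i "nat (- 1 - j)"] by simp
    with state_unique ij final void show ?thesis by blast
  qed
qed

end

lemma (in grid_model) phi_T_avoids_final_iff:
  assumes "sem M w0 (phi_T a l r u d void pos lpos rpos T)" "turing_machine T" "void \<notin> states T"
  shows "sem M w0 (CK (Neg (Atom (final T)))) \<longleftrightarrow> \<not> halts T"
proof -
  obtain e where e: "grid_map M l r u d e" "e 0 0 = w0" "\<And>i j. e i j \<in> reach"
    "\<And>v. v \<in> reach \<Longrightarrow> \<exists>i j. th M v = th M (e i j)"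
    using grid_map_ex by blast
  let ?L = "\<lambda>i j p. e i j \<in> val M p"
  have "sem M v (psi_sane l r u d void pos lpos rpos T) \<and> sem M v (psi_T l r u pos T)" if "v \<in> reach" for v
    using assms(1) that by (simp add: phi_T_def reach_def)
  then have "sane_labels void pos lpos rpos T ?L i j \<and> run_labels pos T ?L i j" for i j
    using sem_psi_sane[OF e(1) assms(2)] sem_psi_T[OF e(1) assms(2)] e(3) by blast
  moreover have "?L 0 0 (start T)" "?L 0 0 pos"
    using assms(1) e(2) by (auto simp: phi_T_def)
  ultimately have "(\<exists>i j. ?L i j (final T)) \<longleftrightarrow> halts T"
    using final_label_iff_halts[of T void pos lpos rpos ?L] assms by blast
  moreover have "(\<exists>i j. ?L i j (final T)) \<longleftrightarrow> (\<exists>v\<in>reach. v \<in> val M (final T))"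
  proof -
    \<comment> \<open>Atoms are \<open>aulc\<close> formulas, so a world and the grid point sharing
      its theory carry the same labels.\<close>
    have "v \<in> val M p \<longleftrightarrow> Atom p \<in> th M v" for v p by (simp add: th_def)
    with e show ?thesis by metis
  qed
  ultimately show ?thesis by (auto simp: reach_def)
qed

section \<open>The grid labelled by the run\<close>

context
  fixes a l r u d :: "'x::finite" and f :: "int \<times> int \<Rightarrow> 'w" and L :: "int \<Rightarrow> int \<Rightarrow> 'p \<Rightarrow> bool"
  assumes agents: "distinct [a, l, r, u, d]" and f: "inj f"
begin

definition shift :: "'x \<Rightarrow> int \<times> int \<Rightarrow> int \<times> int" where
  "shift x = (\<lambda>(i, j). if x = l then (i - 1, j) else if x = r then (i + 1, j)
     else if x = u then (i, j + 1) else if x = d then (i, j - 1) else (i, j))"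

text \<open>The parameter \<open>f\<close> places the grid inside an arbitrary type of worlds. Agent
  \<open>a\<close> gets exactly the loops, as \<open>shift a\<close> is the identity.\<close>

definition grid_of :: "('w, 'p, 'x) model" where
  "grid_of = \<lparr>worlds = range f,
     rel = (\<lambda>x. if x \<in> {a, l, r, u, d} then {(f c, f (shift x c)) | c. True} else {}),
     val = (\<lambda>p. {f (i, j) | i j. L i j p})\<rparr>"

lemma is_model_grid_of: "is_model grid_of"
  by (auto simp: is_model_def grid_of_def)

lemma rel_grid_of:
  "(f c, v) \<in> rel grid_of x \<longleftrightarrow> x \<in> {a, l, r, u, d} \<and> v = f (shift x c)"
  using inj_eq[OF f] by (cases c) (auto simp: grid_of_def)

lemma shift_simps:
  "shift a c = c" "shift l (i, j) = (i - 1, j)" "shift r (i, j) = (i + 1, j)"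
  "shift u (i, j) = (i, j + 1)" "shift d (i, j) = (i, j - 1)"
  using agents by (auto simp: shift_def split: prod.split)

lemma val_grid_of: "f (i, j) \<in> val grid_of p \<longleftrightarrow> L i j p"
  using f by (auto simp: grid_of_def dest: injD)

lemma grid_map_grid_of: "grid_map grid_of l r u d (\<lambda>i j. f (i, j))"
  by (simp add: grid_map_def rel_grid_of shift_simps)

text \<open>Updates only delete arrows, so after any update \<open>f (shift x c)\<close> is still
  the only possible \<open>x\<close>-successor of \<open>f c\<close>. The quantified conjuncts then
  reduce to identities between compositions of shifts.\<close>

lemma psi_grid_grid_of: "sem grid_of (f c) (psi_grid a l r u d)"
proof -
  have all: "sem grid_of w (All \<phi>)"
    if "\<And>M'. (\<And>x c v. (f c, v) \<in> rel M' x \<Longrightarrow> v = f (shift x c)) \<Longrightarrow> sem M' w \<phi>" for w \<phi>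
    unfolding sem.simps(6,7) by (intro allI impI that) (simp add: rel_grid_of)
  have ref: "sem grid_of (f c) (All (Box a (Dia a Top)))"
    by (rule all, simp) (metis shift_simps(1))
  have dir: "sem grid_of (f c) (All (Imp (Dia x (Dia a Top)) (Box x (Dia a Top))))" for x
    by (rule all, simp) metis
  have inv: "sem grid_of (f c) (All (Imp (Dia a Top) (BigAnd (INV l r u d) (\<lambda>(x, y). Box x (Box y (Dia a Top))))))"
  proof (rule all)
    fix M' :: "('w, 'p, 'x) model" assume succ: "\<And>x c v. (f c, v) \<in> rel M' x \<Longrightarrow> v = f (shift x c)"
    have "shift y (shift x c) = c" if "(x, y) \<in> INV l r u d" for x y
      using that by (cases c) (auto simp: INV_def shift_simps)
    then have "sem M' (f c) (Imp (Dia a Top) (Box x (Box y (Dia a Top))))" if "(x, y) \<in> INV l r u d" for x y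
      using that by simp (metis succ)
    moreover have fin: "finite (INV l r u d)"
      by (simp add: INV_def)
    ultimately show "sem M' (f c) (Imp (Dia a Top) (BigAnd (INV l r u d) (\<lambda>(x, y). Box x (Box y (Dia a Top)))))"
      unfolding sem_derived(2) sem_BigAnd[OF fin] by fast
  qed
  have comm: "sem grid_of (f c) (All (BigAnd (COMM l r u d)
      (\<lambda>(x, y). Imp (Dia x (Dia y (Dia a Top))) (Box y (Box x (Dia a Top))))))"
  proof (rule all)
    fix M' :: "('w, 'p, 'x) model" assume succ: "\<And>x c v. (f c, v) \<in> rel M' x \<Longrightarrow> v = f (shift x c)"
    have "shift y (shift x c) = shift x (shift y c)" if "(x, y) \<in> COMM l r u d" for x y
      using that by (cases c) (auto simp: COMM_def shift_simps)
    then have "sem M' (f c) (Imp (Dia x (Dia y (Dia a Top))) (Box y (Box x (Dia a Top))))"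
      if "(x, y) \<in> COMM l r u d" for x y
      using that by simp (metis succ)
    moreover have fin: "finite (COMM l r u d)"
      by (simp add: COMM_def)
    ultimately show "sem M' (f c) (BigAnd (COMM l r u d)
        (\<lambda>(x, y). Imp (Dia x (Dia y (Dia a Top))) (Box y (Box x (Dia a Top)))))"
      unfolding sem_BigAnd[OF fin] by fast
  qed
  show ?thesis
    using ref dir inv comm
    by (simp add: psi_grid_def ref_a_def no_other_def direction_def inverse_fm_def commute_def rel_grid_of)
qed

lemma phi_T_grid_of:
  assumes "turing_machine T" "\<And>i j. sane_labels void pos lpos rpos T L i j" "\<And>i j. run_labels pos T L i j"
    "L 0 0 (start T)" "L 0 0 pos"
  shows "sem grid_of (f (0, 0)) (phi_T a l r u d void pos lpos rpos T)"
proof -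
  have "v \<in> range f" if "(f (0, 0), v) \<in> (\<Union>x. rel grid_of x)\<^sup>*" for v
    using that by (induction rule: rtrancl_induct) (auto simp: rel_grid_of)
  moreover have "sem grid_of v (psi_sane l r u d void pos lpos rpos T) \<and> sem grid_of v (psi_T l r u pos T) \<and>
      sem grid_of v (psi_grid a l r u d)" if "v \<in> range f" for v
    using that assms psi_grid_grid_of sem_psi_sane[OF grid_map_grid_of assms(1)]
      sem_psi_T[OF grid_map_grid_of assms(1)]
    by (auto simp: val_grid_of)
  ultimately show ?thesis
    using assms by (auto simp: phi_T_def val_grid_of)
qed

end

section \<open>The run as a labelling of the grid\<close>

definition run_grid :: "'p \<Rightarrow> 'p \<Rightarrow> 'p \<Rightarrow> 'p \<Rightarrow> ('p, 'p) tm \<Rightarrow> int \<Rightarrow> int \<Rightarrow> 'p \<Rightarrow> bool" where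
  "run_grid void pos lpos rpos T i j p \<longleftrightarrow>
     (if j < 0 then p = void \<or> p = blank T
      else case config_at T (nat j) of (s, h, t) \<Rightarrow>
        p = s \<or> p = t i \<or> p = pos \<and> i = h \<or> p = rpos \<and> i > h \<or> p = lpos \<and> i < h)"

context
  fixes T :: "('p, 'p) tm" and void pos lpos rpos :: 'p
  assumes T: "turing_machine T"
    and start_not_reentered: "\<And>\<alpha> s. \<alpha> \<in> alphabet T \<Longrightarrow> s \<in> states T \<Longrightarrow> trans2 T (\<alpha>, s) \<noteq> start T"
    and atoms: "states T \<inter> alphabet T = {}" "distinct [void, pos, lpos, rpos]"
      "{void, pos, lpos, rpos} \<inter> (states T \<union> alphabet T) = {}"
begin

lemma run_grid_neg:
  assumes "j < 0"
  shows "run_grid void pos lpos rpos T i j p \<longleftrightarrow> p = void \<or> p = blank T"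
  using assms by (simp add: run_grid_def)

lemma run_grid_nonneg:
  assumes "config_at T n = (s, h, t)"
  shows "run_grid void pos lpos rpos T i (int n) p \<longleftrightarrow>
    p = s \<or> p = t i \<or> p = pos \<and> i = h \<or> p = rpos \<and> i > h \<or> p = lpos \<and> i < h"
  using assms by (simp add: run_grid_def)

lemma run_grid_start:
  "run_grid void pos lpos rpos T 0 0 (start T)" "run_grid void pos lpos rpos T 0 0 pos"
  by (auto simp: run_grid_def init_config_def)

lemma machine_atoms:
  "start T \<in> states T" "blank T \<in> alphabet T" "void \<notin> states T" "void \<notin> alphabet T"
  "pos \<notin> states T" "pos \<notin> alphabet T" "lpos \<notin> states T" "lpos \<notin> alphabet T"
  "rpos \<notin> states T" "rpos \<notin> alphabet T"
  using T atoms by (auto simp: turing_machine_def)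

lemma sane_run_grid: "sane_labels void pos lpos rpos T (run_grid void pos lpos rpos T) i j"
proof (cases "j < 0")
  case True
  \<comment> \<open>Symbols are copied upwards from negative rows, which have no head. The blanks
    there match the initial tape when row -1 meets row 0.\<close>
  have up: "run_grid void pos lpos rpos T i (j + 1) (blank T)"
  proof (cases "j + 1 < 0")
    case False
    with True have "j + 1 = 0" by simp
    then show ?thesis by (simp add: run_grid_def init_config_def)
  qed (simp add: run_grid_neg)
  have ne: "blank T \<notin> states T" "blank T \<noteq> pos" "blank T \<noteq> lpos" "blank T \<noteq> rpos" "blank T \<noteq> void"
    "start T \<noteq> blank T" "start T \<noteq> void"
    using machine_atoms atoms by auto
  show ?thesis
    unfolding sane_labels_def using True up ne machine_atoms atoms(2)
    by (auto simp: run_grid_neg)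
next
  case False
  then obtain n where n: "j = int n" by (metis not_less nonneg_int_cases)
  obtain s h t where c: "config_at T n = (s, h, t)" by (metis prod.exhaust)
  obtain s' h' t' where c': "config_at T (Suc n) = (s', h', t')" by (metis prod.exhaust)
  have wf: "s \<in> states T" "\<And>i. t i \<in> alphabet T"
    using config_at_wf[OF T c] by auto
  have ne: "s \<noteq> pos" "s \<noteq> lpos" "s \<noteq> rpos" "s \<noteq> void" "t i \<noteq> pos" "t i \<noteq> lpos" "t i \<noteq> rpos" "t i \<noteq> void"
    "t i \<notin> states T" "s \<notin> alphabet T" for i
    using wf(1) wf(2)[of i] machine_atoms atoms by auto
  \<comment> \<open>Here the assumption that the start state is never re-entered is decisive: the
    start label demands a void row below and a blank symbol, which only row 0 is sure to
    satisfy.\<close>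
  have start: "n = 0" if "s = start T"
  proof (rule ccontr)
    assume "n \<noteq> 0"
    then obtain m where m: "n = Suc m" by (metis not0_implies_Suc)
    obtain s1 h1 t1 where c1: "config_at T m = (s1, h1, t1)" by (metis prod.exhaust)
    with c m have "s = trans2 T (t1 h1, s1)" by auto
    with start_not_reentered config_at_wf[OF T c1] that show False by metis
  qed
  have start_blank: "t i = blank T" if "s = start T"
    using start[OF that] c by (auto simp: init_config_def)
  have below: "run_grid void pos lpos rpos T i (int n - 1) void" if "s = start T"
    using start[OF that] by (simp add: run_grid_neg)
  have up: "run_grid void pos lpos rpos T i (int n + 1) (t i)" if "i \<noteq> h"
  proof -
    have "t' i = t i" using c c' that by auto
    then show ?thesis using run_grid_nonneg[OF c', of i "t i"] by (simp add: add_ac)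
  qed
  have "start T \<noteq> t i" "start T \<noteq> pos" "start T \<noteq> lpos" "start T \<noteq> rpos" for i
    using ne(9)[of i] machine_atoms by metis+
  then show ?thesis
    unfolding sane_labels_def n using wf ne start_blank below up machine_atoms atoms(2)
    by (auto simp: run_grid_nonneg[OF c])
qed

lemma run_run_grid: "run_labels pos T (run_grid void pos lpos rpos T) i j"
proof (cases "j < 0")
  case True
  then show ?thesis
    using machine_atoms atoms(2) by (auto simp: run_labels_def run_grid_neg)
next
  case False
  then obtain n where n: "j = int n" by (metis not_less nonneg_int_cases)
  obtain s h t where c: "config_at T n = (s, h, t)" by (metis prod.exhaust)
  have wf: "s \<in> states T" "\<And>i. t i \<in> alphabet T"
    using config_at_wf[OF T c] by auto
  have c': "config_at T (Suc n) = (trans2 T (t h, s), move_head (trans3 T (t h, s)) h, t(h := trans1 T (t h, s)))"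
    using c by simp
  have up: "run_grid void pos lpos rpos T i (int n + 1) p \<longleftrightarrow> run_grid void pos lpos rpos T i (int (Suc n)) p" for i p
    by (simp add: add_ac)
  show ?thesis
    unfolding run_labels_def n
  proof (intro ballI impI, elim conjE)
    fix \<alpha> s1
    assume "\<alpha> \<in> alphabet T" "s1 \<in> states T" "run_grid void pos lpos rpos T i (int n) pos"
      "run_grid void pos lpos rpos T i (int n) s1" "run_grid void pos lpos rpos T i (int n) \<alpha>"
    \<comment> \<open>States, symbols and marks are disjoint kinds of atoms, so the labels of a cell
      determine its configuration data.\<close>
    then have "i = h" "\<alpha> = t h" "s1 = s"
      using wf machine_atoms atoms unfolding run_grid_nonneg[OF c]
      by (metis disjoint_iff distinct_length_2_or_more)+
    then show "run_grid void pos lpos rpos T (move_head (trans3 T (\<alpha>, s1)) i) (int n + 1) pos \<and>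
        run_grid void pos lpos rpos T i (int n + 1) (trans2 T (\<alpha>, s1)) \<and>
        run_grid void pos lpos rpos T i (int n + 1) (trans1 T (\<alpha>, s1))"
      unfolding up run_grid_nonneg[OF c'] by simp
  qed
qed

end

theorem theorem1:
  fixes T :: "('p::countable, 'p) tm"
    and a left right up down :: "'x::finite"
    and void pos lpos rpos :: 'p
  assumes agents_distinct: "distinct [a, left, right, up, down]"
    and T: "turing_machine T"
    and start_not_reentered: "\<And>\<alpha> s. \<alpha> \<in> alphabet T \<Longrightarrow> s \<in> states T \<Longrightarrow> trans2 T (\<alpha>, s) \<noteq> start T"
    and atoms_distinct: "states T \<inter> alphabet T = {}"
      "distinct [void, pos, lpos, rpos]"
      "{void, pos, lpos, rpos} \<inter> (states T \<union> alphabet T) = {}"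
    and worlds_infinite: "infinite (UNIV :: 'w set)"
  shows "(valid TYPE('w)
            (Imp (phi_T a left right up down void pos lpos rpos T) (CK (Neg (Atom (final T)))))
          \<longleftrightarrow> \<not> halts T) \<and>
         (valid TYPE('w)
            (Imp (phi_T a left right up down void pos lpos rpos T) (Neg (CK (Neg (Atom (final T))))))
          \<longleftrightarrow> halts T)"
proof -
  let ?\<phi> = "phi_T a left right up down void pos lpos rpos T"
  let ?\<psi> = "CK (Neg (Atom (final T))) :: ('p, 'x) fm"
  have void: "void \<notin> states T" using atoms_distinct(3) by auto
  have encoded: "sem M w ?\<psi> \<longleftrightarrow> \<not> halts T" if "sem M w ?\<phi>" for M :: "('w, 'p, 'x) model" and w
  proof -
    interpret grid_model M w a left right up down
      by unfold_locales (use agents_distinct that in \<open>auto simp: phi_T_def simp del: sem.simps\<close>)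
    show ?thesis using phi_T_avoids_final_iff that T void by blast
  qed
  \<comment> \<open>An infinite type of worlds contains a copy of the naturals, hence of the
    countable grid.\<close>
  obtain g :: "nat \<Rightarrow> 'w" where g: "inj g"
    using infinite_countable_subset[OF worlds_infinite] by auto
  let ?f = "g \<circ> to_nat :: int \<times> int \<Rightarrow> 'w"
  have f: "inj ?f" using g by (auto intro: inj_compose)
  let ?M = "grid_of a left right up down ?f (run_grid void pos lpos rpos T)"
  have "sem ?M (?f (0, 0)) ?\<phi>"
    by (rule phi_T_grid_of[OF agents_distinct f T])
      (rule sane_run_grid run_run_grid run_grid_start T start_not_reentered atoms_distinct | assumption)+
  moreover have "is_model ?M" "?f (0, 0) \<in> worlds ?M"
    using is_model_grid_of[OF agents_distinct f] by (auto simp: grid_of_def[OF agents_distinct f])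
  \<comment> \<open>Satisfiability of \<open>phi_T\<close> rules out vacuous validity: by
    \<open>encoded\<close> all its models decide \<psi> in the same way, so exactly one of the two
    implications is valid.\<close>
  ultimately obtain M :: "('w, 'p, 'x) model" and w where "is_model M" "w \<in> worlds M" "sem M w ?\<phi>"
    by blast
  with encoded show ?thesis
    unfolding valid_def by (auto simp del: sem.simps(5) simp: sem.simps(2)[of _ _ ?\<psi>])
qed

end
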